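(* Let $\beta_1>0$ and $\beta_2>0$, and let $X(t)=(X_1(t),X_2(t))\in\mathbb{N}^2$, $t\in\{0,1,2,\dots\}$, be the discrete time Markov chain which from a state $(x,y)$ moves to $(x+1,y)$ with probability $\frac{x^{\beta_1}}{x^{\beta_1}+y^{\beta_2}}$ and to $(x,y+1)$ with probability $\frac{y^{\beta_2}}{x^{\beta_1}+y^{\beta_2}}$. For $i=1,2$ let $A_i$ be the event that all but finitely many balls are placed in bin $i$. 1) If both $\beta_1>1$ and $\beta_2>1$, then $\mathsf{P}_{\mathbf{x}}(A_1)+\mathsf{P}_{\mathbf{x}}(A_2)=1$ for any $\mathbf{x}\in\mathbb{N}^2$. 2) If $\beta_1\leq 1$ and $\beta_2>1$, then $\mathsf{P}_{\mathbf{x}}(A_2)=1$ for any $\mathbf{x}\in\mathbb{N}^2$.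
   Context: $\mathbb{N}=\{1,2,\dots\}$. $X_i(t)$ is the number of balls in bin $i$ at time $t$; at each time step exactly one ball is added, to bin 1 (the first coordinate increases by 1) or to bin 2 (the second coordinate increases by 1). $A_i$ is the event that from some finite time on every ball is placed in bin $i$. $\mathsf{P}_{\mathbf{x}}$ denotes the distribution of the chain started at $\mathbf{x}$. *)

theory Defs
  imports "HOL-Probability.Probability"
begin

section \<open>Markov chains in discrete time\<close>

text \<open>
  \<open>X\<close> is a process on \<open>M\<close> with values in a countable state space, started at \<open>x\<close> almost surely.
  The probability \<open>P\<^sub>x\<close> of an event about the chain is the \<open>M\<close>-probability of that event for \<open>X\<close>;
  it is determined by \<open>K\<close> and \<open>x\<close>, whatever the underlying space \<open>M\<close>.
\<close>

definition markov_chain ::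
  "('s::countable \<Rightarrow> 's pmf) \<Rightarrow> 's \<Rightarrow> 'a measure \<Rightarrow> (nat \<Rightarrow> 'a \<Rightarrow> 's) \<Rightarrow> bool" where
  "markov_chain K x M X \<longleftrightarrow>
     prob_space M \<and>
     (\<forall>t. X t \<in> measurable M (count_space UNIV)) \<and>
     (AE \<omega> in M. X 0 \<omega> = x) \<and>
     (\<forall>t h z. \<P>(\<omega> in M. \<forall>s\<le>t. X s \<omega> = h s) > 0 \<longrightarrow>
        \<P>(\<omega> in M. X (Suc t) \<omega> = z \<bar> \<forall>s\<le>t. X s \<omega> = h s) = pmf (K (h t)) z)"

text \<open>
  Such processes exist for every kernel and every initial state: draw independent random maps
  \<open>f\<close> with \<open>f s\<close> distributed as \<open>K s\<close>, and apply them one after the other.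
\<close>

primrec random_map_chain :: "'s \<Rightarrow> nat \<Rightarrow> ('s \<Rightarrow> 's) stream \<Rightarrow> 's" where
  "random_map_chain x 0 \<omega> = x"
| "random_map_chain x (Suc t) \<omega> = random_map_chain (shd \<omega> x) t (stl \<omega>)"

context
  fixes K :: "'s::countable \<Rightarrow> 's pmf"
begin

private abbreviation "F \<equiv> Pi\<^sub>M UNIV (\<lambda>s. measure_pmf (K s))"
private abbreviation "N \<equiv> stream_space F"

interpretation PP: product_prob_space "\<lambda>s. measure_pmf (K s)" UNIV
  by unfold_locales

interpretation PN: prob_space N
  by (rule PP.P.prob_space_stream_space)

lemma measurable_map_at: "(\<lambda>f. f x) \<in> measurable F (count_space UNIV)"
proof -
  have "(\<lambda>f. f x) \<in> measurable F (measure_pmf (K x))"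
    by (rule measurable_component_singleton) simp
  thus ?thesis by simp
qed

lemma measurable_random_map_chain:
  "random_map_chain x t \<in> measurable N (count_space UNIV)"
proof (induction t arbitrary: x)
  case 0
  thus ?case by simp
next
  case (Suc t)
  have "(\<lambda>\<omega>. (\<lambda>y \<omega>. random_map_chain y t (stl \<omega>)) (shd \<omega> x) \<omega>) \<in> measurable N (count_space UNIV)"
  proof (rule measurable_compose_countable[where g = "\<lambda>\<omega>. shd \<omega> x"])
    show "(\<lambda>\<omega>. random_map_chain y t (stl \<omega>)) \<in> measurable N (count_space UNIV)" for y
      by (rule measurable_compose[OF measurable_stl Suc])
    show "(\<lambda>\<omega>. shd \<omega> x) \<in> measurable N (count_space UNIV)"
      by (rule measurable_compose[OF measurable_shd measurable_map_at])
  qed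
  thus ?case by simp
qed

lemma sets_random_map_chain:
  "{\<omega> \<in> space N. \<forall>s\<le>t. random_map_chain x s \<omega> = h s} \<in> sets N"
proof -
  note measurable_random_map_chain[measurable]
  show ?thesis by measurable
qed

lemma emeasure_random_map_chain:
  "emeasure N {\<omega> \<in> space N. \<forall>s\<le>t. random_map_chain x s \<omega> = h s} =
     (if h 0 = x then \<Prod>i<t. ennreal (pmf (K (h i)) (h (Suc i))) else 0)"
proof (induction t arbitrary: x h)
  case 0
  thus ?case using PN.emeasure_space_1 by auto
next
  case (Suc t)
  have split: "(\<forall>s\<le>Suc t. random_map_chain x s (f ## \<omega>) = h s) \<longleftrightarrow>
      h 0 = x \<and> (\<forall>s\<le>t. random_map_chain (f x) s \<omega> = h (Suc s))" for f \<omega>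
  proof -
    have "(\<forall>s\<le>Suc t. P s) \<longleftrightarrow> P 0 \<and> (\<forall>s\<le>t. P (Suc s))" for P
      by (metis Suc_le_mono not0_implies_Suc zero_le)
    from this[of "\<lambda>s. random_map_chain x s (f ## \<omega>) = h s"] show ?thesis by auto
  qed
  have cyl: "{\<omega> \<in> space N. f ## \<omega> \<in> {\<omega> \<in> space N. \<forall>s\<le>Suc t. random_map_chain x s \<omega> = h s}} =
      (if h 0 = x then {\<omega> \<in> space N. \<forall>s\<le>t. random_map_chain (f x) s \<omega> = h (Suc s)} else {})"
    if "f \<in> space F" for f
    using that by (auto simp: split stream_space_Stream)
  let ?p = "\<Prod>i<t. ennreal (pmf (K (h (Suc i))) (h (Suc (Suc i))))"
  have "emeasure N {\<omega> \<in> space N. \<forall>s\<le>Suc t. random_map_chain x s \<omega> = h s} =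
      (\<integral>\<^sup>+f. (if h 0 = x then emeasure N {\<omega> \<in> space N. \<forall>s\<le>t. random_map_chain (f x) s \<omega> = h (Suc s)} else 0) \<partial>F)"
    by (subst PP.P.emeasure_stream_space[OF sets_random_map_chain], rule nn_integral_cong)
      (subst cyl, simp_all)
  also have "\<dots> = (\<integral>\<^sup>+f. (if h 0 = x then ?p * indicator {f \<in> space F. f x = h (Suc 0)} f else 0) \<partial>F)"
    by (intro nn_integral_cong) (auto simp: Suc split: split_indicator)
  also have "\<dots> = (if h 0 = x then ?p * emeasure F {f \<in> space F. f x = h (Suc 0)} else 0)"
  proof -
    have "{f \<in> space F. f x = h (Suc 0)} \<in> sets F"
      using measurable_map_at[of x] by measurable
    thus ?thesis by (auto intro!: nn_integral_cmult_indicator)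
  qed
  also have "emeasure F {f \<in> space F. f x = h (Suc 0)} = ennreal (pmf (K x) (h (Suc 0)))"
    using PP.emeasure_PiM_Collect_single[of x "{h (Suc 0)}"]
    by (simp add: emeasure_pmf_single)
  finally show ?case
    by (simp add: prod.lessThan_Suc_shift mult.commute del: prod.lessThan_Suc)
qed

lemma markov_chain_random_map_chain: "markov_chain K x N (random_map_chain x)"
  unfolding markov_chain_def
proof (intro conjI allI impI)
  fix t h z
  assume pos: "\<P>(\<omega> in N. \<forall>s\<le>t. random_map_chain x s \<omega> = h s) > 0"
  define g where "g = h(Suc t := z)"
  have eq: "\<P>(\<omega> in N. \<forall>s\<le>t. random_map_chain x s \<omega> = k s) =
     (if k 0 = x then \<Prod>i<t. pmf (K (k i)) (k (Suc i)) else 0)" for k t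
    unfolding measure_def emeasure_random_map_chain
    by (auto simp: prod_ennreal prod_nonneg)
  have g: "random_map_chain x (Suc t) \<omega> = z \<and> (\<forall>s\<le>t. random_map_chain x s \<omega> = h s) \<longleftrightarrow>
      (\<forall>s\<le>Suc t. random_map_chain x s \<omega> = g s)" for \<omega>
    by (auto simp: g_def le_Suc_eq simp del: random_map_chain.simps(2))
  have "(\<Prod>i<t. pmf (K (g i)) (g (Suc i))) = (\<Prod>i<t. pmf (K (h i)) (h (Suc i)))"
    by (intro prod.cong) (auto simp: g_def)
  moreover have "g t = h t" "g (Suc t) = z" "g 0 = h 0" by (auto simp: g_def)
  ultimately have "\<P>(\<omega> in N. \<forall>s\<le>Suc t. random_map_chain x s \<omega> = g s) =
      \<P>(\<omega> in N. \<forall>s\<le>t. random_map_chain x s \<omega> = h s) * pmf (K (h t)) z"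
    unfolding eq prod.lessThan_Suc by simp
  thus "\<P>(\<omega> in N. random_map_chain x (Suc t) \<omega> = z \<bar> \<forall>s\<le>t. random_map_chain x s \<omega> = h s) =
      pmf (K (h t)) z"
    using pos unfolding cond_prob_def g by simp
qed (simp_all add: PN.prob_space_axioms measurable_random_map_chain)

end

section \<open>The balls-in-bins chain\<close>

datatype bin = Bin1 | Bin2

fun add_ball :: "bin \<Rightarrow> nat \<times> nat \<Rightarrow> nat \<times> nat" where
  "add_ball Bin1 (x, y) = (Suc x, y)"
| "add_ball Bin2 (x, y) = (x, Suc y)"

text \<open>
  The parameter of \<open>bernoulli_pmf\<close> lies in \<open>[0, 1]\<close>, and the ball goes to bin 2 with the
  complementary probability. The state space of the chain is the set of pairs of positive numbers,
  which is closed under adding balls; the kernel has no meaning on pairs with a zero entry.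
\<close>

definition balls_kernel :: "real \<Rightarrow> real \<Rightarrow> nat \<times> nat \<Rightarrow> (nat \<times> nat) pmf" where
  "balls_kernel \<beta>1 \<beta>2 = (\<lambda>(x, y).
     map_pmf (\<lambda>b. add_ball (if b then Bin1 else Bin2) (x, y))
       (bernoulli_pmf (real x powr \<beta>1 / (real x powr \<beta>1 + real y powr \<beta>2))))"

lemma pmf_balls_kernel:
  assumes "x \<ge> 1" "y \<ge> 1"
  shows "pmf (balls_kernel \<beta>1 \<beta>2 (x, y)) (x + 1, y) =
           real x powr \<beta>1 / (real x powr \<beta>1 + real y powr \<beta>2)"
    and "pmf (balls_kernel \<beta>1 \<beta>2 (x, y)) (x, y + 1) =
           real y powr \<beta>2 / (real x powr \<beta>1 + real y powr \<beta>2)"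
proof -
  let ?a = "real x powr \<beta>1" and ?b = "real y powr \<beta>2"
  have pos: "?a > 0" "?b > 0" using assms by auto
  hence sum: "?a + ?b > 0" by linarith
  with pos have p: "0 \<le> ?a / (?a + ?b)" "?a / (?a + ?b) \<le> 1"
    by (simp_all add: divide_le_eq_1)
  have *: "(\<lambda>b. add_ball (if b then Bin1 else Bin2) (x, y)) -` {(x + 1, y)} = {True}"
    "(\<lambda>b. add_ball (if b then Bin1 else Bin2) (x, y)) -` {(x, y + 1)} = {False}"
    by (auto split: if_splits)
  show "pmf (balls_kernel \<beta>1 \<beta>2 (x, y)) (x + 1, y) = ?a / (?a + ?b)"
    using p by (simp only: balls_kernel_def prod.case pmf_map * measure_pmf_single pmf_bernoulli_True)
  have "1 - ?a / (?a + ?b) = ?b / (?a + ?b)"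
    using sum by (metis add_diff_cancel_left' diff_divide_distrib divide_self less_irrefl)
  thus "pmf (balls_kernel \<beta>1 \<beta>2 (x, y)) (x, y + 1) = ?b / (?a + ?b)"
    using p by (simp only: balls_kernel_def prod.case pmf_map * measure_pmf_single pmf_bernoulli_False)
qed

definition placed_in :: "bin \<Rightarrow> (nat \<Rightarrow> nat \<times> nat) \<Rightarrow> nat \<Rightarrow> bool" where
  "placed_in i v t \<longleftrightarrow> v (Suc t) = add_ball i (v t)"

definition monopoly :: "'a measure \<Rightarrow> (nat \<Rightarrow> 'a \<Rightarrow> nat \<times> nat) \<Rightarrow> bin \<Rightarrow> 'a set" where
  "monopoly M X i = {\<omega> \<in> space M. \<forall>\<^sub>F t in sequentially. placed_in i (\<lambda>s. X s \<omega>) t}"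

end

theory Submission
  imports Defs
begin

text \<open>
  The proof rests on a family of product-form harmonic functions. Write \<open>w k = k powr \<beta>1\<close> and
  \<open>v k = k powr \<beta>2\<close>. For every complex \<open>\<mu>\<close> the function
  \<open>F x * G y\<close> with \<open>F x = (\<Prod>k<x. 1 + \<mu> / w k)\<close> and \<open>G y = (\<Prod>k<y. 1 - \<mu> / v k)\<close> is harmonic for the
  balls-in-bins kernel, because the mean of the two possible growth factors is
  \<open>w x / (w x + v y) * (1 + \<mu> / w x) + v y / (w x + v y) * (1 - \<mu> / v y) = 1\<close>
  (\<open>birth_prod_harmonic\<close>). Hence its expectation along the chain is constant in time. These functions
  are what remains of the embedding of the two bins into independent pure birth processes
  when the continuous time is eliminated: if both processes explode and \<open>\<mu>\<close> is imaginary, they are, up to a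
  constant factor, the characteristic function of the difference of the two remaining times to explosion.

  A path on which bin 1 receives only finitely many balls belongs to \<open>A\<^sub>2\<close>, and vice versa, so
  everything reduces to excluding divergence of the coordinates.

  If \<open>\<beta>1 \<le> 1 < \<beta>2\<close>, take \<open>\<mu> = 1/2\<close>. Then \<open>F\<close> tends to infinity because \<open>\<Sum>k. 1 / w k\<close> diverges, while
  \<open>G\<close> stays above a positive constant because \<open>\<Sum>k. 1 / v k\<close> converges. By Fatou's lemma the limit
  inferior of \<open>F (X\<^sub>1 t) * G (X\<^sub>2 t)\<close> is finite almost surely, so bin 1 cannot receive infinitely many balls
  (\<open>AE_no_divergence_Bin1\<close>).

  If \<open>\<beta>1 > 1\<close> and \<open>\<beta>2 > 1\<close>, take \<open>\<mu> = \<i> * \<theta>\<close> with real \<open>\<theta>\<close>. Both products converge to nonzero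
  limits; dividing by the limits gives a harmonic function of modulus at most 1. Along a path on which
  both coordinates diverge it tends to 1, for every \<open>\<theta>\<close>. Along any other path some coordinate stops
  at a value \<open>m\<close>, and the limit has modulus \<open>O(1 / \<theta>)\<close>, as has the initial value. Equating the expected limit with
  the initial value and letting \<open>\<theta>\<close> tend to infinity shows that the event of double divergence has
  probability 0 (\<open>AE_no_double_divergence\<close>). In the embedding this is the absence of an atom at 0
  of the difference of the explosion times, read off from the decay of its characteristic function.
\<close>

section \<open>Expectations along a Markov chain\<close>

lemma nn_integral_discrete_law:
  fixes Y :: "'a \<Rightarrow> 's::countable"
  assumes Y: "Y \<in> measurable M (count_space UNIV)"
  shows "(\<integral>\<^sup>+\<omega>. g (Y \<omega>) \<partial>M) =
    (\<integral>\<^sup>+u. emeasure M {\<omega> \<in> space M. Y \<omega> = u} * g u \<partial>count_space UNIV)"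
proof -
  have "distr M (count_space UNIV) Y =
      density (count_space UNIV) (\<lambda>u. emeasure M {\<omega> \<in> space M. Y \<omega> = u})"
  proof (rule measure_eqI_countable[of _ UNIV])
    fix a
    have "Y -` {a} \<inter> space M = {\<omega> \<in> space M. Y \<omega> = a}" by auto
    then show "emeasure (distr M (count_space UNIV) Y) {a} =
        emeasure (density (count_space UNIV) (\<lambda>u. emeasure M {\<omega> \<in> space M. Y \<omega> = u})) {a}"
      using Y by (simp add: emeasure_distr emeasure_density)
  qed auto
  moreover have "(\<integral>\<^sup>+\<omega>. g (Y \<omega>) \<partial>M) = (\<integral>\<^sup>+u. g u \<partial>distr M (count_space UNIV) Y)"
    using Y by (simp add: nn_integral_distr)
  ultimately show ?thesis
    by (simp add: nn_integral_density)
qed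

text \<open>
  The defining condition speaks of full histories. There are only countably many histories of a given length,
  so summing it over those that end in \<open>s\<close> gives the joint law of two consecutive states.
\<close>
lemma markov_chain_pair_law:
  fixes K :: "'s::countable \<Rightarrow> 's pmf"
  assumes mc: "markov_chain K x M X"
  shows "emeasure M {\<omega> \<in> space M. X t \<omega> = s \<and> X (Suc t) \<omega> = z} =
    emeasure M {\<omega> \<in> space M. X t \<omega> = s} * ennreal (pmf (K s) z)"
proof -
  interpret prob_space M using mc by (simp add: markov_chain_def)
  have X[measurable]: "X r \<in> measurable M (count_space UNIV)" for r
    using mc by (simp add: markov_chain_def)
  \<comment> \<open>Coding a history as a list makes the history a random variable with countably many values.\<close>
  define hist where "hist \<omega> = map (\<lambda>r. X r \<omega>) [0..<Suc t]" for \<omega>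
  have hist_eq: "hist \<omega> = l \<longleftrightarrow> length l = Suc t \<and> (\<forall>r\<le>t. X r \<omega> = l ! r)" for \<omega> l
    unfolding hist_def list_eq_iff_nth_eq
    by (auto simp: less_Suc_eq_le nth_append simp del: upt_Suc)
  have [measurable]: "hist \<in> measurable M (count_space UNIV)"
  proof (rule measurable_count_space_eq_countable[THEN iffD2], safe)
    fix l :: "'s list"
    have "hist -` {l} \<inter> space M =
        {\<omega> \<in> space M. length l = Suc t \<and> (\<forall>r\<le>t. X r \<omega> = l ! r)}"
      using hist_eq by auto
    then show "hist -` {l} \<inter> space M \<in> sets M" by simp
  qed auto
  have split: "emeasure M {\<omega> \<in> space M. P \<omega>} =
      (\<integral>\<^sup>+l. emeasure M {\<omega> \<in> space M. hist \<omega> = l \<and> P \<omega>} \<partial>count_space UNIV)"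
    if [measurable]: "Measurable.pred M P" for P
  proof -
    have "emeasure M {\<omega> \<in> space M. P \<omega>} =
        emeasure M (\<Union>l. {\<omega> \<in> space M. hist \<omega> = l \<and> P \<omega>})"
      by (rule arg_cong[of _ _ "emeasure M"]) auto
    also have "\<dots> = (\<integral>\<^sup>+l. emeasure M {\<omega> \<in> space M. hist \<omega> = l \<and> P \<omega>} \<partial>count_space UNIV)"
      by (rule emeasure_UN_countable) (auto simp: disjoint_family_on_def)
    finally show ?thesis .
  qed
  have step: "emeasure M {\<omega> \<in> space M. hist \<omega> = l \<and> X t \<omega> = s \<and> X (Suc t) \<omega> = z} =
      emeasure M {\<omega> \<in> space M. hist \<omega> = l \<and> X t \<omega> = s} * ennreal (pmf (K s) z)" for l
  proof (cases "length l = Suc t \<and> l ! t = s")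
    case False
    then have no: "\<not> (hist \<omega> = l \<and> X t \<omega> = s)" for \<omega> by (auto simp: hist_eq)
    then have "{\<omega> \<in> space M. hist \<omega> = l \<and> X t \<omega> = s} = {}"
      "{\<omega> \<in> space M. hist \<omega> = l \<and> X t \<omega> = s \<and> X (Suc t) \<omega> = z} = {}" by blast+
    then show ?thesis by (simp only: emeasure_empty mult_zero_left)
  next
    case True
    let ?B = "\<lambda>\<omega>. \<forall>r\<le>t. X r \<omega> = l ! r"
    have B: "hist \<omega> = l \<and> X t \<omega> = s \<longleftrightarrow> ?B \<omega>" for \<omega>
      using True by (auto simp: hist_eq)
    have "\<P>(\<omega> in M. X (Suc t) \<omega> = z \<and> ?B \<omega>) = \<P>(\<omega> in M. ?B \<omega>) * pmf (K s) z"
    proof (cases "\<P>(\<omega> in M. ?B \<omega>) > 0")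
      case pos: True
      then have "\<P>(\<omega> in M. X (Suc t) \<omega> = z \<bar> ?B \<omega>) = pmf (K (l ! t)) z"
        using mc unfolding markov_chain_def by blast
      then show ?thesis using pos True
        unfolding cond_prob_def by (simp add: field_simps)
    next
      case False
      then have "\<P>(\<omega> in M. ?B \<omega>) = 0" by (simp add: zero_less_measure_iff)
      moreover have "\<P>(\<omega> in M. X (Suc t) \<omega> = z \<and> ?B \<omega>) \<le> \<P>(\<omega> in M. ?B \<omega>)"
        by (rule finite_measure_mono) auto
      ultimately show ?thesis by (simp add: measure_le_0_iff)
    qed
    moreover have "{\<omega> \<in> space M. hist \<omega> = l \<and> X t \<omega> = s} = {\<omega> \<in> space M. ?B \<omega>}"
      "{\<omega> \<in> space M. hist \<omega> = l \<and> X t \<omega> = s \<and> X (Suc t) \<omega> = z} =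
        {\<omega> \<in> space M. X (Suc t) \<omega> = z \<and> ?B \<omega>}"
      using B by auto
    ultimately show ?thesis
      by (simp add: emeasure_eq_measure ennreal_mult)
  qed
  have "emeasure M {\<omega> \<in> space M. X t \<omega> = s \<and> X (Suc t) \<omega> = z} =
      (\<integral>\<^sup>+l. emeasure M {\<omega> \<in> space M. hist \<omega> = l \<and> X t \<omega> = s} * ennreal (pmf (K s) z)
        \<partial>count_space UNIV)"
    by (subst split) (auto simp: step)
  also have "\<dots> = emeasure M {\<omega> \<in> space M. X t \<omega> = s} * ennreal (pmf (K s) z)"
    by (subst split[of "\<lambda>\<omega>. X t \<omega> = s"]) (auto simp: nn_integral_multc)
  finally show ?thesis .
qed

lemma markov_chain_nn_integral_step:
  fixes K :: "'s::countable \<Rightarrow> 's pmf"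
  assumes mc: "markov_chain K x M X"
  shows "(\<integral>\<^sup>+\<omega>. g (X t \<omega>) (X (Suc t) \<omega>) \<partial>M) =
    (\<integral>\<^sup>+\<omega>. (\<integral>\<^sup>+z. g (X t \<omega>) z \<partial>K (X t \<omega>)) \<partial>M)"
proof -
  have X[measurable]: "X r \<in> measurable M (count_space UNIV)" for r
    using mc by (simp add: markov_chain_def)
  let ?e = "\<lambda>s. emeasure M {\<omega> \<in> space M. X t \<omega> = s}"
  have "(\<integral>\<^sup>+\<omega>. g (X t \<omega>) (X (Suc t) \<omega>) \<partial>M) =
      (\<integral>\<^sup>+\<omega>. case_prod g (X t \<omega>, X (Suc t) \<omega>) \<partial>M)" by simp
  also have "\<dots> = (\<integral>\<^sup>+u. emeasure M {\<omega> \<in> space M. (X t \<omega>, X (Suc t) \<omega>) = u} * case_prod g u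
      \<partial>count_space UNIV)"
    by (rule nn_integral_discrete_law) measurable
  also have "\<dots> = (\<integral>\<^sup>+u. (case u of (s, z) \<Rightarrow> ?e s * (ennreal (pmf (K s) z) * g s z)) \<partial>count_space UNIV)"
    by (intro nn_integral_cong) (auto simp: markov_chain_pair_law[OF mc] mult.assoc)
  also have "\<dots> = (\<integral>\<^sup>+s. \<integral>\<^sup>+z. ?e s * (ennreal (pmf (K s) z) * g s z)
      \<partial>count_space UNIV \<partial>count_space UNIV)"
    by (subst nn_integral_fst_count_space[symmetric]) simp
  also have "\<dots> = (\<integral>\<^sup>+s. ?e s * (\<integral>\<^sup>+z. g s z \<partial>K s) \<partial>count_space UNIV)"
    by (simp add: nn_integral_cmult nn_integral_measure_pmf)
  also have "\<dots> = (\<integral>\<^sup>+\<omega>. (\<integral>\<^sup>+z. g (X t \<omega>) z \<partial>K (X t \<omega>)) \<partial>M)"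
    by (rule nn_integral_discrete_law[symmetric]) simp
  finally show ?thesis .
qed

text \<open>Apply the step formula to the indicator of an impossible transition.\<close>
lemma markov_chain_AE_step:
  fixes K :: "'s::countable \<Rightarrow> 's pmf"
  assumes mc: "markov_chain K x M X"
  shows "AE \<omega> in M. \<forall>t. X (Suc t) \<omega> \<in> set_pmf (K (X t \<omega>))"
  unfolding AE_all_countable
proof
  fix t
  have X[measurable]: "X r \<in> measurable M (count_space UNIV)" for r
    using mc by (simp add: markov_chain_def)
  let ?g = "\<lambda>s z. indicator (- set_pmf (K s)) z :: ennreal"
  have "(\<integral>\<^sup>+z. ?g s z \<partial>K s) = 0" for s
    by (subst nn_integral_0_iff_AE) (auto simp: AE_measure_pmf_iff)
  then have "(\<integral>\<^sup>+\<omega>. ?g (X t \<omega>) (X (Suc t) \<omega>) \<partial>M) = 0"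
    by (subst markov_chain_nn_integral_step[OF mc]) simp
  moreover have "(\<lambda>\<omega>. ?g (X t \<omega>) (X (Suc t) \<omega>)) \<in> borel_measurable M"
    by (rule measurable_compose_countable[where g = "X t"])
      (rule measurable_compose[OF X], auto)
  ultimately have "AE \<omega> in M. ?g (X t \<omega>) (X (Suc t) \<omega>) = 0"
    by (simp add: nn_integral_0_iff_AE)
  then show "AE \<omega> in M. X (Suc t) \<omega> \<in> set_pmf (K (X t \<omega>))"
    by eventually_elim (auto simp: indicator_def split: if_splits)
qed

text \<open>
  Harmonicity is required only on a closed set \<open>S\<close> containing the starting state: the
  balls kernel is meaningful, and the functions below harmonic, only on pairs of positive numbers.
\<close>
lemma markov_chain_nn_integral_harmonic:
  fixes K :: "'s::countable \<Rightarrow> 's pmf"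
  assumes mc: "markov_chain K x M X"
    and S: "x \<in> S" "\<And>s z. s \<in> S \<Longrightarrow> z \<in> set_pmf (K s) \<Longrightarrow> z \<in> S"
    and f: "\<And>s. s \<in> S \<Longrightarrow> (\<integral>\<^sup>+z. f z \<partial>K s) = f s"
  shows "(\<integral>\<^sup>+\<omega>. f (X t \<omega>) \<partial>M) = f x"
proof -
  interpret prob_space M using mc by (simp add: markov_chain_def)
  have X0: "AE \<omega> in M. X 0 \<omega> = x" using mc by (simp add: markov_chain_def)
  have inS: "AE \<omega> in M. X t \<omega> \<in> S" for t
    using markov_chain_AE_step[OF mc] X0
  proof eventually_elim
    case (elim \<omega>)
    show ?case using elim S by (induction t) auto
  qed
  show ?thesis
  proof (induction t)
    case 0
    have "(\<integral>\<^sup>+\<omega>. f (X 0 \<omega>) \<partial>M) = (\<integral>\<^sup>+\<omega>. f x \<partial>M)"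
      by (rule nn_integral_cong_AE, rule eventually_mono[OF X0]) simp
    then show ?case by (simp add: emeasure_space_1)
  next
    case (Suc t)
    have "(\<integral>\<^sup>+\<omega>. f (X (Suc t) \<omega>) \<partial>M) = (\<integral>\<^sup>+\<omega>. (\<integral>\<^sup>+z. f z \<partial>K (X t \<omega>)) \<partial>M)"
      by (rule markov_chain_nn_integral_step[OF mc])
    also have "\<dots> = (\<integral>\<^sup>+\<omega>. f (X t \<omega>) \<partial>M)"
      by (rule nn_integral_cong_AE, rule eventually_mono[OF inS[of t]]) (rule f)
    finally show ?case using Suc by simp
  qed
qed

section \<open>Product-form harmonic functions\<close>

text \<open>
  The weights will be \<open>w k = real k powr \<beta>\<close>. As \<open>0 powr \<beta> = 0\<close> and division by zero yields zero, the factor for \<open>k = 0\<close>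
  is then 1, and the product effectively starts at \<open>k = 1\<close>.
\<close>
definition birth_prod :: "(nat \<Rightarrow> real) \<Rightarrow> 'a::real_normed_field \<Rightarrow> nat \<Rightarrow> 'a" where
  "birth_prod w \<mu> n = (\<Prod>k<n. 1 + \<mu> / of_real (w k))"

lemma birth_prod_Suc: "birth_prod w \<mu> (Suc n) = birth_prod w \<mu> n * (1 + \<mu> / of_real (w n))"
  by (simp add: birth_prod_def)

text \<open>
  A ball in bin 1 multiplies the product by \<open>1 + \<mu> / w x\<close>, a ball in bin 2 by \<open>1 - \<mu> / v y\<close>;
  the transition probabilities are proportional to \<open>w x\<close> and \<open>v y\<close>, so the increments \<open>\<mu>\<close> and \<open>-\<mu>\<close> cancel in the mean.
\<close>
lemma birth_prod_harmonic:
  fixes \<mu> :: "'a::real_normed_field"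
  assumes "w x > 0" "v y > 0"
  shows "of_real (w x / (w x + v y)) * (birth_prod w \<mu> (Suc x) * birth_prod v (-\<mu>) y) +
    of_real (v y / (w x + v y)) * (birth_prod w \<mu> x * birth_prod v (-\<mu>) (Suc y)) =
    birth_prod w \<mu> x * birth_prod v (-\<mu>) y"
proof -
  define a :: 'a where "a = of_real (w x)"
  define b :: 'a where "b = of_real (v y)"
  have nz: "a \<noteq> 0" "b \<noteq> 0" "a + b \<noteq> 0"
    using assms by (auto simp: a_def b_def simp flip: of_real_add)
  have "a / (a + b) * (1 + \<mu> / a) + b / (a + b) * (1 - \<mu> / b) = 1"
    using nz by (simp add: divide_simps)
  note one = this
  have "p * (F * c * G) + q * (F * (G * d)) = F * G * (p * c + q * d)" for p q c d F G :: 'a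
    by (simp add: algebra_simps)
  then have "a / (a + b) * (F * (1 + \<mu> / a) * G) + b / (a + b) * (F * (G * (1 - \<mu> / b))) = F * G"
    for F G :: 'a
    by (simp only: one mult_1_right)
  then show ?thesis
    by (simp add: birth_prod_Suc a_def b_def)
qed

lemma birth_prod_tendsto:
  fixes \<mu> :: "'a::{real_normed_field,banach}"
  assumes w: "\<And>k. w k \<ge> 0" "summable (\<lambda>k. 1 / w k)"
    and nz: "\<And>k. 1 + \<mu> / of_real (w k) \<noteq> 0"
  obtains L where "L \<noteq> 0" "birth_prod w \<mu> \<longlonglongrightarrow> L"
proof -
  have "summable (\<lambda>k. norm \<mu> * (1 / w k))" by (intro summable_mult w)
  then have "abs_convergent_prod (\<lambda>k. 1 + \<mu> / of_real (w k))"
    unfolding abs_convergent_prod_conv_summable using w by (simp add: norm_divide)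
  then have c: "convergent_prod (\<lambda>k. 1 + \<mu> / of_real (w k))"
    by (rule abs_convergent_prod_imp_convergent_prod)
  then have "birth_prod w \<mu> \<longlonglongrightarrow> (\<Prod>k. 1 + \<mu> / of_real (w k))"
    unfolding birth_prod_def LIMSEQ_lessThan_iff_atMost by (rule convergent_prod_LIMSEQ)
  with that prodinf_nonzero[OF c nz] show thesis by blast
qed

text \<open>
  Normalised at infinity, the product becomes \<open>\<Prod>k\<ge>n. 1 / (1 + \<i> * \<theta> / w k)\<close>. This is \<open>E (exp (- \<i> * \<theta> * T))\<close> for
  the sum \<open>T\<close> of independent exponential variables with rates \<open>w n, w (n + 1), \<dots>\<close>, the remaining
  time to explosion of a pure birth process in state \<open>n\<close>.
\<close>
definition residual_factor :: "(nat \<Rightarrow> real) \<Rightarrow> real \<Rightarrow> nat \<Rightarrow> complex" where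
  "residual_factor w \<theta> n = birth_prod w (\<i> * \<theta>) n / lim (birth_prod w (\<i> * \<theta>))"

text \<open>
  Every factor \<open>1 + \<i> * \<theta> / w k\<close> has real part 1, so the modulus increases with \<open>n\<close> to its limit 1. The
  single factor with index \<open>n\<close> already gives the decay in \<open>\<theta>\<close>, through its imaginary part.
\<close>
lemma residual_factor:
  assumes w: "\<And>k. w k \<ge> 0" "summable (\<lambda>k. 1 / w k)"
  shows residual_factor_tendsto: "residual_factor w \<theta> \<longlonglongrightarrow> 1"
    and norm_residual_factor_le_1: "norm (residual_factor w \<theta> n) \<le> 1"
    and norm_residual_factor_le: "w n > 0 \<Longrightarrow> \<theta> \<noteq> 0 \<Longrightarrow> norm (residual_factor w \<theta> n) \<le> w n / \<bar>\<theta>\<bar>"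
proof -
  let ?z = "\<lambda>k. 1 + (\<i> * complex_of_real \<theta>) / of_real (w k)"
  have Re: "Re (?z k) = 1" and Im: "Im (?z k) = \<theta> / w k" for k
    by (simp_all add: Re_divide_of_real Im_divide_of_real)
  have nz: "?z k \<noteq> 0" for k using Re[of k] by (metis zero_complex.simps(1) zero_neq_one)
  obtain L where L: "L \<noteq> 0" "birth_prod w (\<i> * complex_of_real \<theta>) \<longlonglongrightarrow> L"
    using birth_prod_tendsto[OF w nz] .
  have limL: "lim (birth_prod w (\<i> * complex_of_real \<theta>)) = L" using L(2) by (rule limI)
  have R: "residual_factor w \<theta> = (\<lambda>n. birth_prod w (\<i> * complex_of_real \<theta>) n / L)"
    by (simp add: residual_factor_def limL fun_eq_iff)
  have "(\<lambda>n. birth_prod w (\<i> * complex_of_real \<theta>) n / L) \<longlonglongrightarrow> L / L"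
    by (intro tendsto_divide L tendsto_const)
  then show lim: "residual_factor w \<theta> \<longlonglongrightarrow> 1" using L R by simp
  have Suc: "residual_factor w \<theta> (Suc n) = residual_factor w \<theta> n * ?z n" for n
    by (simp add: R birth_prod_Suc)
  have z1: "1 \<le> norm (?z k)" for k using abs_Re_le_cmod[of "?z k"] unfolding Re by simp
  have "incseq (\<lambda>n. norm (residual_factor w \<theta> n))"
    unfolding incseq_Suc_iff Suc norm_mult using z1
    by (metis mult.right_neutral mult_left_mono norm_ge_zero)
  moreover have "(\<lambda>n. norm (residual_factor w \<theta> n)) \<longlonglongrightarrow> 1"
    using tendsto_norm[OF lim] by simp
  ultimately show le1: "norm (residual_factor w \<theta> n) \<le> 1" for n by (rule incseq_le)
  assume pos: "w n > 0" "\<theta> \<noteq> 0"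
  have "norm (residual_factor w \<theta> n) * (\<bar>\<theta>\<bar> / w n) \<le> norm (residual_factor w \<theta> n) * norm (?z n)"
    using abs_Im_le_cmod[of "?z n"] pos unfolding Im by (intro mult_left_mono) auto
  also have "\<dots> \<le> 1" using le1[of "Suc n"] by (simp only: Suc norm_mult)
  finally show "norm (residual_factor w \<theta> n) \<le> w n / \<bar>\<theta>\<bar>"
    using pos by (simp add: field_simps)
qed

lemma residual_factor_harmonic:
  assumes "w x > 0" "v y > 0"
  shows "w x / (w x + v y) * Re (residual_factor w \<theta> (Suc x) * residual_factor v (-\<theta>) y) +
    v y / (w x + v y) * Re (residual_factor w \<theta> x * residual_factor v (-\<theta>) (Suc y)) =
    Re (residual_factor w \<theta> x * residual_factor v (-\<theta>) y)"
proof -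
  let ?L = "lim (birth_prod w (\<i> * \<theta>)) * lim (birth_prod v (-(\<i> * \<theta>)))"
  have R: "residual_factor w \<theta> x * residual_factor v (-\<theta>) y =
      birth_prod w (\<i> * \<theta>) x * birth_prod v (-(\<i> * \<theta>)) y / ?L" for x y
    by (simp add: residual_factor_def)
  have "of_real (w x / (w x + v y)) * (residual_factor w \<theta> (Suc x) * residual_factor v (-\<theta>) y) +
      of_real (v y / (w x + v y)) * (residual_factor w \<theta> x * residual_factor v (-\<theta>) (Suc y)) =
      residual_factor w \<theta> x * residual_factor v (-\<theta>) y"
    unfolding R times_divide_eq_right add_divide_distrib[symmetric]
    by (simp only: birth_prod_harmonic[of w x v y, OF assms])
  moreover have Re_scale: "Re (of_real r * z) = r * Re z" for r z by simp
  ultimately show ?thesis by (metis plus_complex.sel(1))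
qed

section \<open>Monotone integer sequences\<close>

lemma incseq_nat_cases:
  fixes c :: "nat \<Rightarrow> nat"
  assumes "incseq c"
  obtains "filterlim c at_top sequentially" | m where "\<forall>\<^sub>F t in sequentially. c t = m"
proof (cases "\<forall>Z. \<exists>T. Z \<le> c T")
  case True
  have "filterlim c at_top sequentially"
    unfolding filterlim_at_top eventually_sequentially
  proof
    fix Z
    obtain T where "Z \<le> c T" using True by blast
    then have "\<forall>t\<ge>T. Z \<le> c t" using incseqD[OF assms, of T] by (auto intro: order_trans)
    then show "\<exists>T. \<forall>t\<ge>T. Z \<le> c t" ..
  qed
  then show ?thesis by (rule that)
next
  case False
  then obtain Z where Z: "\<forall>t. c t < Z" by (auto simp: not_le)
  let ?m = "Max (range c)"
  have fin: "finite (range c)"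
    by (rule finite_subset[of _ "{..<Z}"]) (use Z in auto)
  then obtain T where T: "c T = ?m" using Max_in[OF fin] by (metis empty_not_UNIV image_is_empty rangeE)
  have "c t = ?m" if "T \<le> t" for t
    using incseqD[OF assms that] T Max_ge[OF fin, of "c t"] by auto
  then show ?thesis using that(2) by (auto simp: eventually_sequentially)
qed

text \<open>
  The dichotomy behind the limit \<open>\<theta> \<longlonglongrightarrow> \<infinity>\<close>: a coordinate that diverges contributes the limit 1 for every \<open>\<theta>\<close>,
  and one that stops contributes a limit that vanishes as \<open>\<theta>\<close> grows. The bound \<open>c 0 \<ge> 1\<close> keeps the
  final value away from 0, where the weight may vanish and nothing decays.
\<close>
lemma residual_factor_along_path:
  fixes c :: "nat \<Rightarrow> nat"
  assumes c: "incseq c" "c 0 \<ge> 1" and u: "\<And>k. u k \<ge> 0" "summable (\<lambda>k. 1 / u k)"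
    and upos: "\<And>k. k \<ge> 1 \<Longrightarrow> u k > 0"
  shows "\<exists>r. (\<forall>\<theta>. (\<lambda>t. residual_factor u \<theta> (c t)) \<longlonglongrightarrow> r \<theta>) \<and> (\<forall>\<theta>. norm (r \<theta>) \<le> 1) \<and>
    (if filterlim c at_top sequentially then r = (\<lambda>_. 1)
     else \<exists>C. \<forall>\<theta>. \<theta> \<noteq> 0 \<longrightarrow> norm (r \<theta>) \<le> C / \<bar>\<theta>\<bar>)"
  using c(1)
proof (cases rule: incseq_nat_cases)
  case 1
  have "(\<lambda>t. residual_factor u \<theta> (c t)) \<longlonglongrightarrow> 1" for \<theta>
    by (rule filterlim_compose[OF residual_factor_tendsto[OF u] 1])
  then show ?thesis using 1 by (intro exI[of _ "\<lambda>_. 1"]) simp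
next
  case (2 m)
  have "\<forall>\<^sub>F t in sequentially. c t = m \<and> c 0 \<le> c t"
    using 2 by eventually_elim (use incseqD[OF c(1), of 0] in auto)
  then have "m \<ge> 1" using c(2) by (auto simp: eventually_sequentially)
  have "\<not> filterlim c at_top sequentially"
  proof
    assume "filterlim c at_top sequentially"
    then have "\<forall>\<^sub>F t in sequentially. Suc m \<le> c t" by (simp add: filterlim_at_top)
    with 2 have "\<forall>\<^sub>F t in sequentially. False" by eventually_elim simp
    then show False by simp
  qed
  moreover have "(\<lambda>t. residual_factor u \<theta> (c t)) \<longlonglongrightarrow> residual_factor u \<theta> m" for \<theta>
    by (rule tendsto_eventually) (use 2 in \<open>eventually_elim, simp\<close>)
  ultimately show ?thesis
    using norm_residual_factor_le_1[OF u] norm_residual_factor_le[OF u upos[OF \<open>m \<ge> 1\<close>]]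
    by (intro exI[of _ "\<lambda>\<theta>. residual_factor u \<theta> m"]) auto
qed

section \<open>Paths of the balls-in-bins chain\<close>

lemma nn_integral_balls_kernel:
  fixes f :: "nat \<times> nat \<Rightarrow> real"
  assumes xy: "x \<ge> 1" "y \<ge> 1" and f: "\<And>s. f s \<ge> 0"
  shows "(\<integral>\<^sup>+z. ennreal (f z) \<partial>balls_kernel \<beta>1 \<beta>2 (x, y)) = ennreal (
    real x powr \<beta>1 / (real x powr \<beta>1 + real y powr \<beta>2) * f (Suc x, y) +
    real y powr \<beta>2 / (real x powr \<beta>1 + real y powr \<beta>2) * f (x, Suc y))"
proof -
  let ?a = "real x powr \<beta>1" and ?b = "real y powr \<beta>2"
  have pos: "?a > 0" "?b > 0" using xy by auto
  then have p: "0 \<le> ?a / (?a + ?b)" "?a / (?a + ?b) \<le> 1" and q: "0 \<le> ?b / (?a + ?b)"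
    using add_pos_pos[OF pos] by (simp_all add: divide_le_eq_1)
  have q': "1 - ?a / (?a + ?b) = ?b / (?a + ?b)"
    using add_pos_pos[OF pos] by (metis add_diff_cancel_left' diff_divide_distrib divide_self less_irrefl)
  have "(\<integral>\<^sup>+z. ennreal (f z) \<partial>balls_kernel \<beta>1 \<beta>2 (x, y)) =
      ennreal (f (Suc x, y)) * ennreal (?a / (?a + ?b)) +
      ennreal (f (x, Suc y)) * ennreal (1 - ?a / (?a + ?b))"
    using p by (simp add: balls_kernel_def)
  also have "\<dots> = ennreal (f (Suc x, y) * (?a / (?a + ?b)) + f (x, Suc y) * (?b / (?a + ?b)))"
    unfolding q' using p(1) q f by (simp only: ennreal_mult ennreal_plus mult_nonneg_nonneg)
  finally show ?thesis by (simp only: mult.commute)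
qed

lemma set_pmf_balls_kernel: "set_pmf (balls_kernel \<beta>1 \<beta>2 s) \<subseteq> {add_ball Bin1 s, add_ball Bin2 s}"
  by (cases s) (auto simp: balls_kernel_def split: if_splits)

lemma balls_chain_harmonic:
  fixes f :: "nat \<times> nat \<Rightarrow> real"
  assumes mc: "markov_chain (balls_kernel \<beta>1 \<beta>2) (x, y) M X" and xy: "x \<ge> 1" "y \<ge> 1"
    and f: "\<And>s. f s \<ge> 0"
    and harm: "\<And>x y. x \<ge> 1 \<Longrightarrow> y \<ge> 1 \<Longrightarrow>
      real x powr \<beta>1 / (real x powr \<beta>1 + real y powr \<beta>2) * f (Suc x, y) +
      real y powr \<beta>2 / (real x powr \<beta>1 + real y powr \<beta>2) * f (x, Suc y) = f (x, y)"
  shows "(\<integral>\<^sup>+\<omega>. ennreal (f (X t \<omega>)) \<partial>M) = ennreal (f (x, y))"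
proof (rule markov_chain_nn_integral_harmonic[OF mc, of "{1..} \<times> {1..}"])
  fix s z assume "s \<in> {1::nat..} \<times> {1::nat..}" "z \<in> set_pmf (balls_kernel \<beta>1 \<beta>2 s)"
  then show "z \<in> {1..} \<times> {1..}" using set_pmf_balls_kernel[of \<beta>1 \<beta>2 s] by (cases s) auto
next
  fix s assume "s \<in> {1::nat..} \<times> {1::nat..}"
  then show "(\<integral>\<^sup>+z. ennreal (f z) \<partial>balls_kernel \<beta>1 \<beta>2 s) = ennreal (f s)"
    using nn_integral_balls_kernel[OF _ _ f] harm by (cases s) auto
qed (use xy in auto)

lemma balls_path:
  assumes mc: "markov_chain (balls_kernel \<beta>1 \<beta>2) (x, y) M X"
  shows "AE \<omega> in M. X 0 \<omega> = (x, y) \<and>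
    (\<forall>t. placed_in Bin1 (\<lambda>s. X s \<omega>) t \<or> placed_in Bin2 (\<lambda>s. X s \<omega>) t)"
proof -
  have "AE \<omega> in M. X 0 \<omega> = (x, y)" using mc by (simp add: markov_chain_def)
  with markov_chain_AE_step[OF mc] show ?thesis
  proof eventually_elim
    case (elim \<omega>)
    have "X (Suc t) \<omega> \<in> {add_ball Bin1 (X t \<omega>), add_ball Bin2 (X t \<omega>)}" for t
      using elim(1) set_pmf_balls_kernel by blast
    then show ?case using elim(2) by (auto simp: placed_in_def)
  qed
qed

lemma incseq_balls:
  assumes "\<And>t. placed_in Bin1 v t \<or> placed_in Bin2 v t"
  shows "incseq (\<lambda>t. fst (v t))" "incseq (\<lambda>t. snd (v t))"
proof -
  have "fst (v t) \<le> fst (v (Suc t)) \<and> snd (v t) \<le> snd (v (Suc t))" for t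
    using assms[of t] by (cases "v t") (auto simp: placed_in_def)
  then show "incseq (\<lambda>t. fst (v t))" "incseq (\<lambda>t. snd (v t))"
    by (auto simp: incseq_Suc_iff)
qed

lemma eventually_placed_in:
  assumes v: "\<And>t. placed_in Bin1 v t \<or> placed_in Bin2 v t"
  shows "\<forall>\<^sub>F t in sequentially. fst (v t) = m \<Longrightarrow> \<forall>\<^sub>F t in sequentially. placed_in Bin2 v t"
    and "\<forall>\<^sub>F t in sequentially. snd (v t) = m \<Longrightarrow> \<forall>\<^sub>F t in sequentially. placed_in Bin1 v t"
proof -
  have 1: "placed_in Bin2 v t" if "fst (v t) = m" "fst (v (Suc t)) = m" for t
    using v[of t] that by (cases "v t"; cases "v (Suc t)") (auto simp: placed_in_def)
  have 2: "placed_in Bin1 v t" if "snd (v t) = m" "snd (v (Suc t)) = m" for t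
    using v[of t] that by (cases "v t"; cases "v (Suc t)") (auto simp: placed_in_def)
  show "\<forall>\<^sub>F t in sequentially. placed_in Bin2 v t" if "\<forall>\<^sub>F t in sequentially. fst (v t) = m"
    using that eventually_sequentially_Suc[THEN iffD2, OF that] by eventually_elim (rule 1)
  show "\<forall>\<^sub>F t in sequentially. placed_in Bin1 v t" if "\<forall>\<^sub>F t in sequentially. snd (v t) = m"
    using that eventually_sequentially_Suc[THEN iffD2, OF that] by eventually_elim (rule 2)
qed

lemma sets_monopoly:
  assumes "markov_chain K s M X"
  shows "monopoly M X i \<in> sets M"
proof -
  have [measurable]: "X t \<in> measurable M (count_space UNIV)" for t
    using assms by (simp add: markov_chain_def)
  have "placed_in i (\<lambda>s. X s \<omega>) t \<longleftrightarrow> (\<exists>s. X t \<omega> = s \<and> X (Suc t) \<omega> = add_ball i s)" for \<omega> t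
    by (simp add: placed_in_def)
  then have "monopoly M X i = {\<omega> \<in> space M.
      \<exists>T. \<forall>t\<ge>T. \<exists>s. X t \<omega> = s \<and> X (Suc t) \<omega> = add_ball i s}"
    by (simp only: monopoly_def eventually_sequentially)
  also have "\<dots> \<in> sets M" by measurable
  finally show ?thesis .
qed

lemma monopoly_disjoint: "monopoly M X Bin1 \<inter> monopoly M X Bin2 = {}"
proof -
  have False if "\<forall>\<^sub>F t in sequentially. placed_in Bin1 v t"
    "\<forall>\<^sub>F t in sequentially. placed_in Bin2 v t" for v
  proof -
    from eventually_conj[OF that] obtain t where "placed_in Bin1 v t" "placed_in Bin2 v t"
      by (auto simp: eventually_sequentially)
    then show False by (cases "v t") (auto simp: placed_in_def)
  qed
  then show ?thesis by (auto simp: monopoly_def)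
qed

section \<open>Divergence of the coordinates\<close>

lemma summable_inverse_powr_iff: "summable (\<lambda>k. 1 / real k powr \<beta>) \<longleftrightarrow> \<beta> > 1"
  using summable_real_powr_iff[of "-\<beta>"] by (simp add: powr_minus_divide)

text \<open>
  Two limits are taken under the integral, both dominated by 1: time to infinity at fixed \<open>\<theta>\<close>, and
  then \<open>\<theta>\<close> to infinity along the positive integers. Only the real part of the harmonic function is used; adding 1 makes it
  nonnegative, so that the expectation can be computed as a nonnegative integral.
\<close>
lemma AE_no_double_divergence:
  assumes "\<beta>1 > 1" "\<beta>2 > 1" and xy: "x \<ge> 1" "y \<ge> 1"
    and mc: "markov_chain (balls_kernel \<beta>1 \<beta>2) (x, y) M X"
  shows "AE \<omega> in M. \<not> (filterlim (\<lambda>t. fst (X t \<omega>)) at_top sequentially \<and>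
    filterlim (\<lambda>t. snd (X t \<omega>)) at_top sequentially)"
proof -
  interpret prob_space M using mc by (simp add: markov_chain_def)
  have X[measurable]: "X t \<in> measurable M (count_space UNIV)" for t
    using mc by (simp add: markov_chain_def)
  define w where "w k = real k powr \<beta>1" for k
  define v where "v k = real k powr \<beta>2" for k
  have w: "w k \<ge> 0" "summable (\<lambda>k. 1 / w k)" and v: "v k \<ge> 0" "summable (\<lambda>k. 1 / v k)"
    and pos: "k \<ge> 1 \<Longrightarrow> w k > 0" "k \<ge> 1 \<Longrightarrow> v k > 0" for k
    using assms(1,2) by (simp_all add: w_def v_def summable_inverse_powr_iff)
  define R where "R \<theta> s = residual_factor w \<theta> (fst s) * residual_factor v (-\<theta>) (snd s)" for \<theta> s
  define h where "h \<theta> s = Re (R \<theta> s)" for \<theta> s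
  have R_le: "norm (R \<theta> s) \<le> 1" for \<theta> s
    unfolding R_def norm_mult
    by (intro mult_le_one norm_residual_factor_le_1 w v norm_ge_zero)
  have h_le: "\<bar>h \<theta> s\<bar> \<le> 1" for \<theta> s
    using abs_Re_le_cmod[of "R \<theta> s"] R_le[of \<theta> s] by (simp add: h_def)
  have [measurable]: "(\<lambda>\<omega>. h \<theta> (X t \<omega>)) \<in> borel_measurable M" for \<theta> t
    by (rule measurable_compose[OF X]) simp

  have mart: "(\<integral>\<omega>. h \<theta> (X t \<omega>) \<partial>M) = h \<theta> (x, y)" for \<theta> t
  proof -
    have nonneg: "0 \<le> 1 + h \<theta> s" for s using h_le[of \<theta> s] by simp
    have "(\<integral>\<^sup>+\<omega>. ennreal (1 + h \<theta> (X t \<omega>)) \<partial>M) = ennreal (1 + h \<theta> (x, y))"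
    proof (rule balls_chain_harmonic[OF mc xy nonneg])
      fix x y :: nat assume "x \<ge> 1" "y \<ge> 1"
      note p = pos(1)[OF this(1)] pos(2)[OF this(2)]
      have "w x / (w x + v y) * h \<theta> (Suc x, y) + v y / (w x + v y) * h \<theta> (x, Suc y) = h \<theta> (x, y)"
        using residual_factor_harmonic[of w x v y, OF p] by (simp add: h_def R_def)
      moreover have "w x / (w x + v y) + v y / (w x + v y) = 1"
        using p by (simp flip: add_divide_distrib)
      ultimately show "real x powr \<beta>1 / (real x powr \<beta>1 + real y powr \<beta>2) * (1 + h \<theta> (Suc x, y)) +
          real y powr \<beta>2 / (real x powr \<beta>1 + real y powr \<beta>2) * (1 + h \<theta> (x, Suc y)) = 1 + h \<theta> (x, y)"
        unfolding w_def v_def by (simp add: distrib_left)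
    qed
    then have "(\<integral>\<omega>. 1 + h \<theta> (X t \<omega>) \<partial>M) = 1 + h \<theta> (x, y)"
      using nonneg by (subst integral_eq_nn_integral) auto
    moreover have "integrable M (\<lambda>\<omega>. h \<theta> (X t \<omega>))"
      by (rule integrable_const_bound[of _ 1]) (use h_le in auto)
    ultimately show ?thesis by (simp add: prob_space)
  qed

  let ?D = "\<lambda>\<omega>. filterlim (\<lambda>t. fst (X t \<omega>)) at_top sequentially \<and>
    filterlim (\<lambda>t. snd (X t \<omega>)) at_top sequentially"
  \<comment> \<open>Defining the pointwise limit by \<open>lim\<close> makes it measurable without reference to the path.\<close>
  define L where "L n \<omega> = lim (\<lambda>t. h (real (Suc n)) (X t \<omega>))" for n \<omega>
  have [measurable]: "L n \<in> borel_measurable M" for n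
    unfolding L_def by measurable
  have [measurable]: "Measurable.pred M ?D"
    unfolding filterlim_at_top eventually_sequentially by measurable

  have lims: "AE \<omega> in M. (\<forall>n. (\<lambda>t. h (real (Suc n)) (X t \<omega>)) \<longlonglongrightarrow> L n \<omega>) \<and>
      (\<lambda>n. L n \<omega>) \<longlonglongrightarrow> indicator {\<omega>. ?D \<omega>} \<omega>"
    using balls_path[OF mc]
  proof eventually_elim
    case (elim \<omega>)
    then have path: "placed_in Bin1 (\<lambda>s. X s \<omega>) t \<or> placed_in Bin2 (\<lambda>s. X s \<omega>) t" for t by blast
    note inc = incseq_balls[of "\<lambda>s. X s \<omega>", OF path]
    have start: "fst (X 0 \<omega>) \<ge> 1" "snd (X 0 \<omega>) \<ge> 1" using elim xy by auto
    obtain r1 where r1: "\<And>\<theta>. (\<lambda>t. residual_factor w \<theta> (fst (X t \<omega>))) \<longlonglongrightarrow> r1 \<theta>"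
      "\<And>\<theta>. norm (r1 \<theta>) \<le> 1"
      "if filterlim (\<lambda>t. fst (X t \<omega>)) at_top sequentially then r1 = (\<lambda>_. 1)
         else \<exists>C. \<forall>\<theta>. \<theta> \<noteq> 0 \<longrightarrow> norm (r1 \<theta>) \<le> C / \<bar>\<theta>\<bar>"
      using residual_factor_along_path[OF inc(1) start(1) w pos(1)] by blast
    obtain r2 where r2: "\<And>\<theta>. (\<lambda>t. residual_factor v \<theta> (snd (X t \<omega>))) \<longlonglongrightarrow> r2 \<theta>"
      "\<And>\<theta>. norm (r2 \<theta>) \<le> 1"
      "if filterlim (\<lambda>t. snd (X t \<omega>)) at_top sequentially then r2 = (\<lambda>_. 1)
         else \<exists>C. \<forall>\<theta>. \<theta> \<noteq> 0 \<longrightarrow> norm (r2 \<theta>) \<le> C / \<bar>\<theta>\<bar>"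
      using residual_factor_along_path[OF inc(2) start(2) v pos(2)] by blast
    have lim: "(\<lambda>t. h \<theta> (X t \<omega>)) \<longlonglongrightarrow> Re (r1 \<theta> * r2 (-\<theta>))" for \<theta>
      unfolding h_def R_def by (intro tendsto_Re tendsto_mult r1 r2)
    have L: "L n \<omega> = Re (r1 (real (Suc n)) * r2 (- real (Suc n)))" for n
      unfolding L_def by (rule limI[OF lim])
    have "(\<lambda>n. L n \<omega>) \<longlonglongrightarrow> indicator {\<omega>. ?D \<omega>} \<omega>"
    proof (cases "?D \<omega>")
      case True
      then show ?thesis using r1(3) r2(3) by (simp add: L)
    next
      case False
      have "\<exists>C. \<forall>\<theta>. \<theta> \<noteq> 0 \<longrightarrow> norm (r1 \<theta> * r2 (-\<theta>)) \<le> C / \<bar>\<theta>\<bar>"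
      proof (cases "filterlim (\<lambda>t. fst (X t \<omega>)) at_top sequentially")
        case False
        then obtain C where "\<And>\<theta>. \<theta> \<noteq> 0 \<Longrightarrow> norm (r1 \<theta>) \<le> C / \<bar>\<theta>\<bar>" using r1(3) by auto
        moreover have "norm (r1 \<theta> * r2 (-\<theta>)) \<le> norm (r1 \<theta>)" for \<theta>
          unfolding norm_mult using r2(2) by (intro mult_right_le_one_le) auto
        ultimately show ?thesis by (meson order_trans)
      next
        case True
        with False r2(3) obtain C where C: "\<And>\<theta>. \<theta> \<noteq> 0 \<Longrightarrow> norm (r2 \<theta>) \<le> C / \<bar>\<theta>\<bar>" by auto
        have "norm (r2 (-\<theta>)) \<le> C / \<bar>\<theta>\<bar>" if "\<theta> \<noteq> 0" for \<theta>
          using C[of "-\<theta>"] that by simp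
        moreover have "norm (r1 \<theta> * r2 (-\<theta>)) \<le> norm (r2 (-\<theta>))" for \<theta>
          unfolding norm_mult using r1(2) by (intro mult_left_le_one_le) auto
        ultimately show ?thesis by (meson order_trans)
      qed
      then obtain C where C: "\<And>\<theta>. \<theta> \<noteq> 0 \<Longrightarrow> norm (r1 \<theta> * r2 (-\<theta>)) \<le> C / \<bar>\<theta>\<bar>" by blast
      have "(\<lambda>n. L n \<omega>) \<longlonglongrightarrow> 0"
      proof (rule Lim_null_comparison)
        show "\<forall>\<^sub>F n in sequentially. norm (L n \<omega>) \<le> C / real (Suc n)"
        proof (rule always_eventually, rule allI)
          fix n
          have "norm (L n \<omega>) \<le> norm (r1 (real (Suc n)) * r2 (- real (Suc n)))"
            unfolding L real_norm_def by (rule abs_Re_le_cmod)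
          also have "\<dots> \<le> C / real (Suc n)" using C[of "real (Suc n)"] by simp
          finally show "norm (L n \<omega>) \<le> C / real (Suc n)" .
        qed
        show "(\<lambda>n. C / real (Suc n)) \<longlonglongrightarrow> 0"
          by (rule LIMSEQ_Suc[OF lim_const_over_n])
      qed
      moreover have "indicator {\<omega>. ?D \<omega>} \<omega> = (0::real)"
        using False by (simp only: indicator_def mem_Collect_eq if_False of_bool_eq)
      ultimately show ?thesis by simp
    qed
    then show ?case using lim unfolding L by blast
  qed

  have L_int: "(\<integral>\<omega>. L n \<omega> \<partial>M) = h (real (Suc n)) (x, y)" for n
  proof -
    have "(\<lambda>t. \<integral>\<omega>. h (real (Suc n)) (X t \<omega>) \<partial>M) \<longlonglongrightarrow> (\<integral>\<omega>. L n \<omega> \<partial>M)"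
      by (rule integral_dominated_convergence[where w = "\<lambda>_. 1"])
        (use lims h_le in \<open>auto elim: eventually_mono\<close>)
    then show ?thesis unfolding mart by (simp add: LIMSEQ_const_iff)
  qed
  have "(\<lambda>n. \<integral>\<omega>. L n \<omega> \<partial>M) \<longlonglongrightarrow> (\<integral>\<omega>. indicator {\<omega>. ?D \<omega>} \<omega> \<partial>M)"
  proof (rule integral_dominated_convergence[where w = "\<lambda>_. 1"])
    have "AE \<omega> in M. \<bar>L n \<omega>\<bar> \<le> 1" for n
      using lims
    proof eventually_elim
      case (elim \<omega>)
      then have "(\<lambda>t. \<bar>h (real (Suc n)) (X t \<omega>)\<bar>) \<longlonglongrightarrow> \<bar>L n \<omega>\<bar>"
        by (intro tendsto_rabs) simp
      then show ?case by (rule LIMSEQ_le_const2) (use h_le in auto)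
    qed
    then show "AE \<omega> in M. norm (L n \<omega>) \<le> 1" for n by simp
    show "AE \<omega> in M. (\<lambda>n. L n \<omega>) \<longlonglongrightarrow> indicator {\<omega>. ?D \<omega>} \<omega>"
      using lims by eventually_elim simp
  qed auto
  moreover have "(\<lambda>n. \<integral>\<omega>. L n \<omega> \<partial>M) \<longlonglongrightarrow> 0"
  proof (rule Lim_null_comparison)
    show "\<forall>\<^sub>F n in sequentially. norm (\<integral>\<omega>. L n \<omega> \<partial>M) \<le> w x / real (Suc n)"
    proof (rule always_eventually, rule allI)
      fix n
      have "norm (\<integral>\<omega>. L n \<omega> \<partial>M) \<le> norm (R (real (Suc n)) (x, y))"
        unfolding L_int h_def real_norm_def by (rule abs_Re_le_cmod)
      also have "\<dots> \<le> norm (residual_factor w (real (Suc n)) x)"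
        unfolding R_def norm_mult using norm_residual_factor_le_1[OF v]
        by (simp add: mult_right_le_one_le)
      also have "\<dots> \<le> w x / real (Suc n)"
        using norm_residual_factor_le[OF w pos(1)[OF xy(1)], of "real (Suc n)"] by simp
      finally show "norm (\<integral>\<omega>. L n \<omega> \<partial>M) \<le> w x / real (Suc n)" .
    qed
    show "(\<lambda>n. w x / real (Suc n)) \<longlonglongrightarrow> 0"
      by (rule LIMSEQ_Suc[OF lim_const_over_n])
  qed
  ultimately have "(\<integral>\<omega>. indicator {\<omega>. ?D \<omega>} \<omega> \<partial>M) = (0::real)"
    by (rule LIMSEQ_unique)
  also have "(\<integral>\<omega>. indicator {\<omega>. ?D \<omega>} \<omega> \<partial>M) = measure M {\<omega> \<in> space M. ?D \<omega>}"
    by (simp add: Int_def conj_commute)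
  finally show ?thesis
    by (subst (asm) prob_eq_0) (auto elim: eventually_mono)
qed

text \<open>
  With \<open>\<mu> = 1/2\<close> all factors of both products are positive, since the weights of
  positive integers are at least 1 in bin 2. The harmonic function blows up along every path on which bin 1 fills without bound,
  whatever bin 2 does, and this contradicts its constant finite expectation.
\<close>
lemma AE_no_divergence_Bin1:
  assumes "\<beta>1 \<le> 1" "\<beta>2 > 1" and xy: "x \<ge> 1" "y \<ge> 1"
    and mc: "markov_chain (balls_kernel \<beta>1 \<beta>2) (x, y) M X"
  shows "AE \<omega> in M. \<not> filterlim (\<lambda>t. fst (X t \<omega>)) at_top sequentially"
proof -
  have X[measurable]: "X t \<in> measurable M (count_space UNIV)" for t
    using mc by (simp add: markov_chain_def)
  define w where "w k = real k powr \<beta>1" for k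
  define v where "v k = real k powr \<beta>2" for k
  have w: "w k \<ge> 0" and v: "v k \<ge> 0" "summable (\<lambda>k. 1 / v k)"
    and pos: "k \<ge> 1 \<Longrightarrow> w k > 0" "k \<ge> 1 \<Longrightarrow> v k > 0" for k
    using assms(2) by (simp_all add: w_def v_def summable_inverse_powr_iff)
  define F :: "nat \<Rightarrow> real" where "F = birth_prod w (1/2)"
  define G :: "nat \<Rightarrow> real" where "G = birth_prod v (-(1/2))"
  have factor: "0 < 1 - 1 / (2 * v k)" "1 - 1 / (2 * v k) \<le> 1" for k
  proof -
    have "k = 0 \<or> v k \<ge> 1" using assms(2) by (cases k) (auto simp: v_def ge_one_powr_ge_zero)
    then show "0 < 1 - 1 / (2 * v k)" by (auto simp: v_def) (simp add: divide_less_eq)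
    show "1 - 1 / (2 * v k) \<le> 1" using v(1)[of k] by simp
  qed
  have Gpos: "G n > 0" for n using factor(1) by (auto simp: G_def birth_prod_def intro!: prod_pos)
  have "decseq G"
    unfolding decseq_Suc_iff
  proof
    fix n
    have "G (Suc n) = G n * (1 - 1 / (2 * v n))" by (simp add: G_def birth_prod_Suc)
    also have "\<dots> \<le> G n"
      using Gpos[of n] factor[of n] by (intro mult_right_le_one_le) auto
    finally show "G (Suc n) \<le> G n" .
  qed
  have "1 + - (1 / 2 :: real) / of_real (v k) \<noteq> 0" for k
  proof -
    have eq: "1 + - (1 / 2 :: real) / of_real (v k) = 1 - 1 / (2 * v k)" by simp
    show ?thesis unfolding eq using factor(1)[of k] by (rule less_imp_neq[THEN not_sym])
  qed
  then obtain g where g: "g \<noteq> 0" "G \<longlonglongrightarrow> g"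
    unfolding G_def using birth_prod_tendsto[OF v, of "-(1/2)"] by blast
  have G_ge: "g \<le> G n" for n using decseq_ge[OF \<open>decseq G\<close> g(2)] .
  have "0 \<le> g" by (rule LIMSEQ_le_const[OF g(2)]) (use Gpos less_imp_le in blast)
  then have "g > 0" using g(1) by simp

  have F_nonneg: "F n \<ge> 0" for n using w by (auto simp: F_def birth_prod_def intro!: prod_nonneg)
  have "incseq F"
    unfolding incseq_Suc_iff using F_nonneg w by (auto simp: F_def birth_prod_Suc distrib_left)
  have F_unbdd: "\<exists>n. C < F n" for C
  proof (rule ccontr)
    assume "\<not> ?thesis"
    then have F_le: "F n \<le> C" for n by (simp add: not_less)
    have "(\<Sum>k<n. 1 / (2 * w k)) \<le> C" for n
    proof -
      have "(\<Sum>k<n. 1 / (2 * w k)) \<le> (\<Prod>k<n. 1 + 1 / (2 * w k))"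
        by (rule sum_le_prod) (use w in auto)
      also have "\<dots> = F n" by (simp add: F_def birth_prod_def)
      finally show ?thesis using F_le[of n] by simp
    qed
    then have "summable (\<lambda>k. 1 / (2 * w k))"
      by (intro summableI_nonneg_bounded[of _ C]) (use w in auto)
    from summable_mult[OF this, of 2] have "summable (\<lambda>k. 1 / w k)" by simp
    then show False using assms(1) by (simp add: w_def summable_inverse_powr_iff)
  qed

  define f where "f s = F (fst s) * G (snd s)" for s
  have mart: "(\<integral>\<^sup>+\<omega>. ennreal (f (X t \<omega>)) \<partial>M) = ennreal (f (x, y))" for t
  proof (rule balls_chain_harmonic[OF mc xy])
    show "f s \<ge> 0" for s
      unfolding f_def by (intro mult_nonneg_nonneg F_nonneg less_imp_le[OF Gpos])
    fix x y :: nat assume "x \<ge> 1" "y \<ge> 1"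
    note p = pos(1)[OF this(1)] pos(2)[OF this(2)]
    show "real x powr \<beta>1 / (real x powr \<beta>1 + real y powr \<beta>2) * f (Suc x, y) +
        real y powr \<beta>2 / (real x powr \<beta>1 + real y powr \<beta>2) * f (x, Suc y) = f (x, y)"
      using birth_prod_harmonic[of w x v y "1/2 :: real", OF p]
      by (simp add: f_def F_def G_def w_def v_def)
  qed
  have [measurable]: "(\<lambda>\<omega>. ennreal (f (X t \<omega>))) \<in> borel_measurable M" for t
    by (rule measurable_compose[OF X]) simp
  have "(\<integral>\<^sup>+\<omega>. liminf (\<lambda>t. ennreal (f (X t \<omega>))) \<partial>M) \<le> liminf (\<lambda>t. \<integral>\<^sup>+\<omega>. ennreal (f (X t \<omega>)) \<partial>M)"
    by (rule nn_integral_liminf) simp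
  also have "\<dots> = ennreal (f (x, y))" unfolding mart by (simp add: Liminf_const)
  finally have "AE \<omega> in M. liminf (\<lambda>t. ennreal (f (X t \<omega>))) \<noteq> \<infinity>"
    by (intro nn_integral_PInf_AE) (auto simp: top_unique)
  then show ?thesis
  proof eventually_elim
    case (elim \<omega>)
    show ?case
    proof
      assume div: "filterlim (\<lambda>t. fst (X t \<omega>)) at_top sequentially"
      have "ennreal (real C) \<le> liminf (\<lambda>t. ennreal (f (X t \<omega>)))" for C :: nat
      proof (rule Liminf_bounded)
        obtain n where n: "real C / g < F n" using F_unbdd by blast
        have "\<forall>\<^sub>F t in sequentially. n \<le> fst (X t \<omega>)" using div by (simp add: filterlim_at_top)
        then show "\<forall>\<^sub>F t in sequentially. ennreal (real C) \<le> ennreal (f (X t \<omega>))"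
        proof eventually_elim
          case (elim t)
          have "real C \<le> F n * g" using n \<open>g > 0\<close> by (simp add: field_simps)
          also have "\<dots> \<le> F (fst (X t \<omega>)) * G (snd (X t \<omega>))"
            using incseqD[OF \<open>incseq F\<close> elim] G_ge \<open>g > 0\<close> F_nonneg by (intro mult_mono) auto
          finally show ?case by (simp add: f_def ennreal_leI)
        qed
      qed
      then have "liminf (\<lambda>t. ennreal (f (X t \<omega>))) = \<infinity>"
        by (metis ennreal_Ex_less_of_nat ennreal_of_nat_eq_real_of_nat infinity_ennreal_def less_top not_le)
      then show False using elim by simp
    qed
  qed
qed

section \<open>Monopoly\<close>

theorem theorem2p1:
  fixes \<beta>1 \<beta>2 :: real
    and x y :: nat
    and M :: "'a measure"
    and X :: "nat \<Rightarrow> 'a \<Rightarrow> nat \<times> nat"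
  assumes "\<beta>1 > 0" and "\<beta>2 > 0"
    and "x \<ge> 1" and "y \<ge> 1"
    and "markov_chain (balls_kernel \<beta>1 \<beta>2) (x, y) M X"
  shows "(\<beta>1 > 1 \<and> \<beta>2 > 1 \<longrightarrow>
            measure M (monopoly M X Bin1) + measure M (monopoly M X Bin2) = 1)
       \<and> (\<beta>1 \<le> 1 \<and> \<beta>2 > 1 \<longrightarrow> measure M (monopoly M X Bin2) = 1)"
proof -
  note mc = assms(5) and xy = assms(3,4)
  interpret prob_space M using mc by (simp add: markov_chain_def)
  note sets = sets_monopoly[OF mc]
  have cases: "AE \<omega> in M.
      (filterlim (\<lambda>t. fst (X t \<omega>)) at_top sequentially \<or> \<omega> \<in> monopoly M X Bin2) \<and>
      (filterlim (\<lambda>t. snd (X t \<omega>)) at_top sequentially \<or> \<omega> \<in> monopoly M X Bin1)"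
    using balls_path[OF mc] AE_space
  proof eventually_elim
    case (elim \<omega>)
    then have path: "placed_in Bin1 (\<lambda>s. X s \<omega>) t \<or> placed_in Bin2 (\<lambda>s. X s \<omega>) t" for t by blast
    note inc = incseq_balls[of "\<lambda>s. X s \<omega>", OF path]
      and ev = eventually_placed_in[of "\<lambda>s. X s \<omega>", OF path]
    have "filterlim (\<lambda>t. fst (X t \<omega>)) at_top sequentially \<or> \<omega> \<in> monopoly M X Bin2"
      using inc(1) by (cases rule: incseq_nat_cases) (use ev(1) elim(2) in \<open>auto simp: monopoly_def\<close>)
    moreover have "filterlim (\<lambda>t. snd (X t \<omega>)) at_top sequentially \<or> \<omega> \<in> monopoly M X Bin1"
      using inc(2) by (cases rule: incseq_nat_cases) (use ev(2) elim(2) in \<open>auto simp: monopoly_def\<close>)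
    ultimately show ?case by blast
  qed
  show ?thesis
  proof (intro conjI impI; elim conjE)
    assume "\<beta>1 > 1" "\<beta>2 > 1"
    from AE_no_double_divergence[OF this xy mc] cases
    have "AE \<omega> in M. \<omega> \<in> monopoly M X Bin1 \<union> monopoly M X Bin2"
      by eventually_elim blast
    then have "prob (monopoly M X Bin1 \<union> monopoly M X Bin2) = 1"
      using sets by (simp add: prob_eq_1)
    then show "prob (monopoly M X Bin1) + prob (monopoly M X Bin2) = 1"
      using finite_measure_Union[OF sets sets monopoly_disjoint] by simp
  next
    assume "\<beta>1 \<le> 1" "\<beta>2 > 1"
    from AE_no_divergence_Bin1[OF this xy mc] cases
    have "AE \<omega> in M. \<omega> \<in> monopoly M X Bin2"
      by eventually_elim blast
    then show "prob (monopoly M X Bin2) = 1"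
      using sets by (simp add: prob_eq_1)
  qed
qed

end
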